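(* For all integers $k\ge 1$ and $\Delta$ there is a constant $C=C(k,\Delta)$ such that if $H$ is any acyclic digraph with $n$ vertices and maximum degree $\Delta$, then $$\overrightarrow{r_k}(H)\le 2^{\,C(\log n)^{2^{2k-1}}}.$$
   Context: All digraphs are finite, simple and oriented (no loops, parallel or anti-parallel edges). The maximum degree of $H$ is $\max_{v}(|N^+(v)|+|N^-(v)|)$. A copy of $H$ in $T$ is given by an injective map $V(H)\to V(T)$ sending edges of $H$ to edges of $T$ with orientations preserved. For an acyclic digraph $H$ and $k\ge1$, $\overrightarrow{r_k}(H)$ is the least $N$ such that every tournament on $N$ vertices whose edges are colored with $k$ colors contains a monochromatic copy of $H$. All logarithms are to base $2$. *)

theory Defs
  imports Complex_Main "Graph_Theory.Pair_Digraph"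
begin

locale oriented_digraph = pair_digraph G for G :: "'a pair_pre_digraph" +
  assumes no_antiparallel: "(u, v) \<in> parcs G \<Longrightarrow> (v, u) \<notin> parcs G"

locale tournament = oriented_digraph G for G :: "'a pair_pre_digraph" +
  assumes semicomplete:
    "\<lbrakk>u \<in> pverts G; v \<in> pverts G; u \<noteq> v\<rbrakk> \<Longrightarrow> (u, v) \<in> parcs G \<or> (v, u) \<in> parcs G"

definition out_nbrs :: "'a pair_pre_digraph \<Rightarrow> 'a \<Rightarrow> 'a set" where
  "out_nbrs G v = {w. (v, w) \<in> parcs G}"

definition in_nbrs :: "'a pair_pre_digraph \<Rightarrow> 'a \<Rightarrow> 'a set" where
  "in_nbrs G v = {w. (w, v) \<in> parcs G}"

definition max_degree :: "'a pair_pre_digraph \<Rightarrow> nat" where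
  "max_degree G = Max ((\<lambda>v. card (out_nbrs G v) + card (in_nbrs G v)) ` pverts G)"

definition is_copy :: "'a pair_pre_digraph \<Rightarrow> 'b pair_pre_digraph \<Rightarrow> ('a \<Rightarrow> 'b) \<Rightarrow> bool" where
  "is_copy H T f \<longleftrightarrow> inj_on f (pverts H) \<and> f ` pverts H \<subseteq> pverts T \<and>
     (\<forall>u v. (u, v) \<in> parcs H \<longrightarrow> (f u, f v) \<in> parcs T)"

definition edge_coloring :: "nat \<Rightarrow> 'b pair_pre_digraph \<Rightarrow> ('b \<times> 'b \<Rightarrow> nat) \<Rightarrow> bool" where
  "edge_coloring k T c \<longleftrightarrow> (\<forall>e \<in> parcs T. c e < k)"

definition has_mono_copy ::
  "nat \<Rightarrow> 'a pair_pre_digraph \<Rightarrow> 'b pair_pre_digraph \<Rightarrow> ('b \<times> 'b \<Rightarrow> nat) \<Rightarrow> bool" where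
  "has_mono_copy k H T c \<longleftrightarrow>
     (\<exists>f. is_copy H T f \<and> (\<exists>i<k. \<forall>u v. (u, v) \<in> parcs H \<longrightarrow> c (f u, f v) = i))"

text \<open>
  Up to isomorphism every finite tournament has its vertices among the natural numbers, so
  quantifying over tournaments on finite sets of naturals loses nothing. For acyclic finite
  \<open>H\<close> and \<open>k \<ge> 1\<close> a suitable \<open>N\<close> exists by Ramsey's theorem.
\<close>

definition oriented_ramsey :: "nat \<Rightarrow> 'a pair_pre_digraph \<Rightarrow> nat" where
  "oriented_ramsey k H =
     (LEAST N. \<forall>(T :: nat pair_pre_digraph) c.
        tournament T \<and> card (pverts T) = N \<and> edge_coloring k T c \<longrightarrow> has_mono_copy k H T c)"

end

theory Submission
  imports Defs
begin

text \<open>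
  Order the vertices of the tournament. Each colour \<open>i\<close> gives two relations on pairs \<open>x < y\<close>: the
  arcs of colour \<open>i\<close> from \<open>x\<close> to \<open>y\<close>, and those from \<open>y\<close> to \<open>x\<close>. Without a monochromatic copy of
  \<open>H\<close>, no forward relation contains \<open>H\<close> and no backward relation contains the reverse of \<open>H\<close>.

  Suppose a relation \<open>R\<close> contains no copy of an acyclic digraph with degrees at most \<open>D\<close>. If we try
  to embed its vertices one at a time into consecutive blocks of vertices, the failure yields
  large sets \<open>A < B\<close> with every vertex of \<open>A\<close> having few \<open>R\<close>-neighbours in \<open>B\<close>. So an
  \<open>R\<close>-independent set found recursively in \<open>A\<close> misses half of \<open>B\<close>, and combines with one found in
  what is left of \<open>B\<close>. Thus \<open>2 ^ O(t\<^sup>2)\<close> vertices suffice for an \<open>R\<close>-independent set of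
  size \<open>2 ^ t\<close> when \<open>t\<close> is at least about \<open>log n\<close>, and \<open>2 ^ O(log n)\<close> vertices suffice for \<open>t = 1\<close>.

  Making the set independent for all \<open>2 * k\<close> relations in turn squares the exponent \<open>2 * k - 1\<close>
  times, starting from \<open>O(log n)\<close>. This leaves two vertices with no arc between them, which is
  impossible in a tournament.
\<close>

section \<open>Copies and independent sets of a relation on an ordered set\<close>

definition embeds :: "'a set \<Rightarrow> 'a rel \<Rightarrow> 'b set \<Rightarrow> 'b rel \<Rightarrow> bool" where
  "embeds V E X R \<longleftrightarrow>
     (\<exists>f. inj_on f V \<and> f ` V \<subseteq> X \<and> (\<forall>u v. (u, v) \<in> E \<longrightarrow> (f u, f v) \<in> R))"

text \<open>Testing only pairs with \<open>x < y\<close> lets forward and backward arcs of one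
  colour be treated as two separate relations.\<close>

definition indep :: "'b::linorder rel \<Rightarrow> 'b set \<Rightarrow> bool" where
  "indep R S \<longleftrightarrow> (\<forall>x\<in>S. \<forall>y\<in>S. x < y \<longrightarrow> (x, y) \<notin> R)"

definition set_less :: "'b::linorder set \<Rightarrow> 'b set \<Rightarrow> bool" where
  "set_less A B \<longleftrightarrow> (\<forall>a\<in>A. \<forall>b\<in>B. a < b)"

lemma set_less_mono: "set_less A B \<Longrightarrow> A' \<subseteq> A \<Longrightarrow> B' \<subseteq> B \<Longrightarrow> set_less A' B'"
  unfolding set_less_def by blast

text \<open>Transfers the absence of \<open>H\<close> in a colour to the backward arcs, where the
  reverse of \<open>H\<close> is the forbidden digraph.\<close>

lemma embeds_converse: "embeds V (E\<inverse>) X (R\<inverse>) \<longleftrightarrow> embeds V E X R"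
  unfolding embeds_def by auto

lemma embeds_mono: "embeds V E X R \<Longrightarrow> X \<subseteq> Y \<Longrightarrow> embeds V E Y R"
  unfolding embeds_def by (meson order_trans)

section \<open>Enumerating the digraph and cutting the ground set into blocks\<close>

text \<open>An acyclic relation on a finite set is well-founded, so a vertex without predecessors
  among the remaining ones can be listed first, again and again.\<close>

lemma topological_enumeration:
  assumes "finite V" "acyclic E" "E \<subseteq> V \<times> V"
  obtains vs where "distinct vs" "set vs = V" "sorted_wrt (\<lambda>u v. (v, u) \<notin> E) vs"
proof -
  have wf: "wf E"
    using assms by (meson finite_SigmaI finite_acyclic_wf finite_subset)
  have "\<exists>vs. distinct vs \<and> set vs = W \<and> sorted_wrt (\<lambda>u v. (v, u) \<notin> E) vs" if "finite W" for W
    using that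
  proof (induction W rule: finite_psubset_induct)
    case (psubset W)
    show ?case
    proof (cases "W = {}")
      case False
      then obtain z where z: "z \<in> W" "\<And>y. (y, z) \<in> E \<Longrightarrow> y \<notin> W"
        using wf wfE_min by (metis ex_in_conv)
      then obtain vs where "distinct vs" "set vs = W - {z}" "sorted_wrt (\<lambda>u v. (v, u) \<notin> E) vs"
        using psubset.IH[of "W - {z}"] by blast
      then show ?thesis
        using z by (intro exI[of _ "z # vs"]) auto
    qed simp
  qed
  then show ?thesis
    using that assms(1) by blast
qed

lemma initial_segment:
  fixes X :: "'b::linorder set"
  assumes "finite X" "s \<le> card X"
  obtains A where "A \<subseteq> X" "card A = s" "set_less A (X - A)"
proof -
  have "\<exists>A\<subseteq>X. card A = s \<and> set_less A (X - A)"
    using assms(2)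
  proof (induction s)
    case 0
    then show ?case by (intro exI[of _ "{}"]) (simp add: set_less_def)
  next
    case (Suc s)
    then obtain A where A: "A \<subseteq> X" "card A = s" "set_less A (X - A)"
      by auto
    have fA: "finite A" and fXA: "finite (X - A)"
      using A assms(1) finite_subset by auto
    have ne: "X - A \<noteq> {}"
    proof
      assume "X - A = {}"
      then have "X = A"
        using A(1) by blast
      then show False
        using A(2) Suc.prems by simp
    qed
    define m where "m = Min (X - A)"
    have m: "m \<in> X - A" "\<And>x. x \<in> X - A \<Longrightarrow> m \<le> x"
      unfolding m_def by (rule Min_in[OF fXA ne]) (rule Min_le[OF fXA])
    have "set_less (insert m A) (X - insert m A)"
      using A(3) m unfolding set_less_def by (metis DiffE DiffI insert_iff order_le_less)
    then show ?case
      using A m fA by (intro exI[of _ "insert m A"]) auto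
  qed
  then show ?thesis using that by blast
qed

text \<open>The smallest \<open>s\<close> elements go to the first vertex and the recursion
  continues on the rest. Distinctness keeps the update of \<open>C\<close> from touching later
  blocks.\<close>

lemma consecutive_blocks:
  fixes X :: "'b::linorder set"
  assumes "finite X" "length vs * s \<le> card X" "distinct vs"
  shows "\<exists>C. (\<forall>v\<in>set vs. C v \<subseteq> X \<and> card (C v) = s) \<and> sorted_wrt (\<lambda>u v. set_less (C u) (C v)) vs"
  using assms
proof (induction vs arbitrary: X)
  case (Cons v vs)
  then have "s \<le> card X"
    by simp
  then obtain A where A: "A \<subseteq> X" "card A = s" "set_less A (X - A)"
    using initial_segment Cons.prems(1) by blast
  have "length vs * s \<le> card (X - A)"
    using Cons.prems A by (simp add: card_Diff_subset finite_subset)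
  then obtain C where C: "\<forall>v\<in>set vs. C v \<subseteq> X - A \<and> card (C v) = s"
    "sorted_wrt (\<lambda>u v. set_less (C u) (C v)) vs"
    using Cons.IH[of "X - A"] Cons.prems by auto
  have "sorted_wrt (\<lambda>u w. set_less ((C(v := A)) u) ((C(v := A)) w)) vs"
    by (rule sorted_wrt_mono_rel[OF _ C(2)]) (use Cons.prems(3) in auto)
  moreover have "\<forall>w\<in>set vs. set_less A (C w)"
    using A(3) C(1) set_less_mono by blast
  ultimately show ?case
    using A C(1) Cons.prems(3) by (intro exI[of _ "C(v := A)"]) auto
qed simp

section \<open>Greedy embedding and sparse pairs\<close>

text \<open>\<open>C v\<close> holds the candidates still possible for \<open>v\<close>. Each
  embedded in-neighbour of \<open>v\<close> shrinks it by a factor of at most \<open>q\<close>, so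
  the exponent counts the in-neighbours still to come and at least \<open>L\<close> candidates
  always remain. The form \<open>L \<le> D * card A\<close> avoids dividing \<open>L\<close> by
  \<open>D\<close>.\<close>

lemma greedy_embedding:
  fixes C :: "'a \<Rightarrow> 'b::linorder set"
  assumes irrefl: "\<And>v. (v, v) \<notin> E"
    and outdeg: "\<And>v. finite (E `` {v})" "\<And>v. card (E `` {v}) \<le> D"
    and "finite X" "L > 0" "q > 0"
    and dense: "\<And>A B. \<lbrakk>A \<subseteq> X; B \<subseteq> X; set_less A B; L \<le> D * card A; L \<le> card B\<rbrakk>
                  \<Longrightarrow> \<exists>a\<in>A. card B \<le> q * card (B \<inter> R `` {a})"
    and "distinct vs" "sorted_wrt (\<lambda>u v. (v, u) \<notin> E) vs"
    and "sorted_wrt (\<lambda>u v. set_less (C u) (C v)) vs"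
    and "\<And>v. v \<in> set vs \<Longrightarrow> C v \<subseteq> X"
    and "\<And>v. v \<in> set vs \<Longrightarrow> L * q ^ card {u \<in> set vs. (u, v) \<in> E} \<le> card (C v)"
  shows "\<exists>f. (\<forall>v\<in>set vs. f v \<in> C v) \<and>
             (\<forall>u\<in>set vs. \<forall>v\<in>set vs. (u, v) \<in> E \<longrightarrow> (f u, f v) \<in> R)"
  using assms(8-)
proof (induction vs arbitrary: C)
  case (Cons v vs)
  define W where "W = E `` {v} \<inter> set vs"
  have size: "L \<le> card (C w)" if "w \<in> set (v # vs)" for w
  proof -
    have "L * 1 \<le> L * q ^ card {u \<in> set (v # vs). (u, w) \<in> E}"
      using \<open>q > 0\<close> by (intro mult_le_mono2) (simp add: Suc_leI)
    then show ?thesis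
      using Cons.prems(5)[OF that] by linarith
  qed
  have finC: "finite (C w)" if "w \<in> set (v # vs)" for w
    using Cons.prems(4)[OF that] \<open>finite X\<close> finite_subset by blast
  have "finite W" "card W \<le> D"
    using outdeg[of v] card_mono[of "E `` {v}" W] unfolding W_def by auto
  \<comment> \<open>Images of \<open>v\<close> that would leave \<open>w\<close> less than a
    \<open>1/q\<close> fraction of its candidates. By density each such set has fewer than
    \<open>L / D\<close> elements, so the at most \<open>D\<close> out-neighbours cannot exclude all
    of \<open>C v\<close>.\<close>
  define bad where "bad w = {x \<in> C v. q * card (C w \<inter> R `` {x}) < card (C w)}" for w
  have bad: "D * card (bad w) < L" if "w \<in> W" for w
  proof (rule ccontr)
    assume "\<not> ?thesis"
    then have "L \<le> D * card (bad w)"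
      by simp
    moreover have "L \<le> card (C w)"
      using size that unfolding W_def by simp
    moreover have "set_less (bad w) (C w)" "bad w \<subseteq> X" "C w \<subseteq> X"
      using that Cons.prems(3,4) unfolding W_def bad_def set_less_def by auto
    ultimately obtain a where "a \<in> bad w" "card (C w) \<le> q * card (C w \<inter> R `` {a})"
      using dense[of "bad w" "C w"] by blast
    then show False
      unfolding bad_def by simp
  qed
  have "\<not> C v \<subseteq> (\<Union>w\<in>W. bad w)"
  proof
    assume sub: "C v \<subseteq> (\<Union>w\<in>W. bad w)"
    have fin: "finite (\<Union>w\<in>W. bad w)"
      using \<open>finite W\<close> finC[of v] unfolding bad_def by auto
    \<comment> \<open>Needed for strictness of the sum below; an empty union could not cover the
      nonempty \<open>C v\<close>.\<close>
    have "W \<noteq> {}"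
      using sub size[of v] \<open>L > 0\<close> by auto
    have "D * card (C v) \<le> D * (\<Sum>w\<in>W. card (bad w))"
      using card_mono[OF fin sub] card_UN_le[OF \<open>finite W\<close>, of bad] by simp
    also have "\<dots> = (\<Sum>w\<in>W. D * card (bad w))"
      by (rule sum_distrib_left)
    also have "\<dots> < (\<Sum>w\<in>W. L)"
      using bad \<open>W \<noteq> {}\<close> \<open>finite W\<close> by (intro sum_strict_mono) auto
    also have "\<dots> \<le> D * L"
      using \<open>card W \<le> D\<close> by simp
    also have "\<dots> \<le> D * card (C v)"
      using size[of v] by simp
    finally show False by simp
  qed
  then obtain x where x: "x \<in> C v" "\<And>w. w \<in> W \<Longrightarrow> card (C w) \<le> q * card (C w \<inter> R `` {x})"
    unfolding bad_def by force
  define C' where "C' w = (if w \<in> W then C w \<inter> R `` {x} else C w)" for w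
  have C'_sub: "C' w \<subseteq> C w" for w
    unfolding C'_def by auto
  have "\<exists>f. (\<forall>v\<in>set vs. f v \<in> C' v) \<and>
            (\<forall>u\<in>set vs. \<forall>v\<in>set vs. (u, v) \<in> E \<longrightarrow> (f u, f v) \<in> R)"
  proof (rule Cons.IH)
    show "distinct vs" "sorted_wrt (\<lambda>u v. (v, u) \<notin> E) vs"
      using Cons.prems by auto
    have "sorted_wrt (\<lambda>u v. set_less (C u) (C v)) vs"
      using Cons.prems(3) by simp
    then show "sorted_wrt (\<lambda>u v. set_less (C' u) (C' v)) vs"
      by (rule sorted_wrt_mono_rel[rotated]) (rule set_less_mono[OF _ C'_sub C'_sub])
    show "C' w \<subseteq> X" if "w \<in> set vs" for w
      using C'_sub[of w] Cons.prems(4)[of w] that by auto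
    show "L * q ^ card {u \<in> set vs. (u, w) \<in> E} \<le> card (C' w)" if w: "w \<in> set vs" for w
    proof (cases "w \<in> W")
      case True
      \<comment> \<open>The factor \<open>q\<close> lost by \<open>C' w\<close> is paid for by
        \<open>v\<close> leaving the in-neighbours of \<open>w\<close> still to be embedded.\<close>
      then have "{u \<in> set (v # vs). (u, w) \<in> E} = insert v {u \<in> set vs. (u, w) \<in> E}"
        unfolding W_def by auto
      moreover have "v \<notin> set vs"
        using Cons.prems(1) by simp
      ultimately have "card {u \<in> set (v # vs). (u, w) \<in> E} = Suc (card {u \<in> set vs. (u, w) \<in> E})"
        by simp
      then have "q * (L * q ^ card {u \<in> set vs. (u, w) \<in> E}) \<le> card (C w)"
        using Cons.prems(5)[of w] w by (simp add: mult.left_commute)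
      also have "\<dots> \<le> q * card (C' w)"
        using x(2)[OF True] True unfolding C'_def by simp
      finally show ?thesis
        using \<open>q > 0\<close> by simp
    next
      case False
      then have "{u \<in> set (v # vs). (u, w) \<in> E} = {u \<in> set vs. (u, w) \<in> E}"
        using w unfolding W_def by auto
      then show ?thesis
        using Cons.prems(5)[of w] w False unfolding C'_def by simp
    qed
  qed
  then obtain f where f: "\<And>v. v \<in> set vs \<Longrightarrow> f v \<in> C' v"
    "\<And>u v. \<lbrakk>u \<in> set vs; v \<in> set vs; (u, v) \<in> E\<rbrakk> \<Longrightarrow> (f u, f v) \<in> R"
    by blast
  have v: "v \<notin> set vs" "\<And>w. w \<in> set vs \<Longrightarrow> (w, v) \<notin> E"
    using Cons.prems(1,2) by auto
  have "f w \<in> C w" if "w \<in> set vs" for w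
    using f(1)[OF that] C'_sub by blast
  moreover have "(x, f w) \<in> R" if "w \<in> set vs" "(v, w) \<in> E" for w
    using f(1)[OF that(1)] that unfolding C'_def W_def by auto
  ultimately show ?case
    using f(2) x(1) v irrefl by (intro exI[of _ "f(v := x)"]) auto
qed simp

text \<open>Contrapositive of the greedy embedding. Blocks of size \<open>L * q ^ D\<close> suffice
  because no vertex has more than \<open>D\<close> in-neighbours.\<close>

lemma sparse_pair:
  fixes X :: "'b::linorder set"
  assumes V: "finite V" "acyclic E" "E \<subseteq> V \<times> V"
    and outdeg: "\<And>v. card (E `` {v}) \<le> D" and indeg: "\<And>v. card (E\<inverse> `` {v}) \<le> D"
    and X: "finite X" "card V * (L * q ^ D) \<le> card X"
    and "L > 0" "q > 0" and no_copy: "\<not> embeds V E X R"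
  obtains A B where "A \<subseteq> X" "B \<subseteq> X" "set_less A B" "L \<le> D * card A" "L \<le> card B"
    "\<And>a. a \<in> A \<Longrightarrow> q * card (B \<inter> R `` {a}) < card B"
proof (rule ccontr)
  note found = that
  assume contra: "\<not> thesis"
  obtain vs where vs: "distinct vs" "set vs = V" "sorted_wrt (\<lambda>u v. (v, u) \<notin> E) vs"
    using topological_enumeration V by blast
  have "length vs = card V"
    using vs distinct_card by metis
  then obtain C where C: "\<And>v. v \<in> V \<Longrightarrow> C v \<subseteq> X" "\<And>v. v \<in> V \<Longrightarrow> card (C v) = L * q ^ D"
    and less: "sorted_wrt (\<lambda>u v. set_less (C u) (C v)) vs"
    using consecutive_blocks[of X vs "L * q ^ D"] X vs by metis
  have irrefl: "(v, v) \<notin> E" for v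
    using V(2) by (meson acyclic_def r_into_trancl')
  have fin: "finite (E `` {v})" "finite (E\<inverse> `` {v})" for v
    using V(1,3) by (auto intro: finite_subset[of _ V])
  have "\<exists>f. (\<forall>v\<in>set vs. f v \<in> C v) \<and>
             (\<forall>u\<in>set vs. \<forall>v\<in>set vs. (u, v) \<in> E \<longrightarrow> (f u, f v) \<in> R)"
  proof (rule greedy_embedding[of E D X L q])
    show "\<exists>a\<in>A. card B \<le> q * card (B \<inter> R `` {a})"
      if "A \<subseteq> X" "B \<subseteq> X" "set_less A B" "L \<le> D * card A" "L \<le> card B" for A B
      using that contra found by (meson linorder_not_less)
    show "L * q ^ card {u \<in> set vs. (u, v) \<in> E} \<le> card (C v)" if "v \<in> set vs" for v
    proof -
      have "card {u \<in> set vs. (u, v) \<in> E} \<le> card (E\<inverse> `` {v})"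
        using fin by (intro card_mono) auto
      then have "card {u \<in> set vs. (u, v) \<in> E} \<le> D"
        using indeg[of v] by linarith
      then show ?thesis
        using C(2) that vs(2) \<open>q > 0\<close> by (simp add: power_increasing)
    qed
  qed (use irrefl fin outdeg X(1) \<open>L > 0\<close> \<open>q > 0\<close> vs C(1) less in auto)
  then obtain f where f: "\<And>v. v \<in> V \<Longrightarrow> f v \<in> C v"
    "\<And>u v. \<lbrakk>u \<in> V; v \<in> V; (u, v) \<in> E\<rbrakk> \<Longrightarrow> (f u, f v) \<in> R"
    using vs(2) by blast
  \<comment> \<open>Injectivity comes from the blocks: distinct vertices have images in blocks one
    of which lies entirely below the other.\<close>
  have "f u \<noteq> f v" if "u \<in> V" "v \<in> V" "u \<noteq> v" for u v
  proof -
    from that obtain i j where ij: "i < length vs" "j < length vs" "vs ! i = u" "vs ! j = v" "i \<noteq> j"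
      using vs(2) by (metis in_set_conv_nth)
    then have "set_less (C u) (C v) \<or> set_less (C v) (C u)"
      using less by (metis linorder_neqE_nat sorted_wrt_nth_less)
    then show ?thesis
      using f(1)[OF that(1)] f(1)[OF that(2)] unfolding set_less_def by (metis less_irrefl)
  qed
  then have "inj_on f V"
    by (meson inj_onI)
  then have "embeds V E X R"
    unfolding embeds_def using f C(1) V(3) by (intro exI[of _ f]) blast
  then show False
    using no_copy by blast
qed

section \<open>Independent sets for a single relation\<close>

text \<open>The separate bound \<open>T\<close> fixes the sparsity \<open>2 * 2 ^ T\<close>, and
  hence the base of the threshold, through the whole induction on \<open>t\<close>.\<close>

lemma large_indep:
  fixes X :: "'b::linorder set"
  assumes V: "finite V" "acyclic E" "E \<subseteq> V \<times> V"
    and outdeg: "\<And>v. card (E `` {v}) \<le> D" and indeg: "\<And>v. card (E\<inverse> `` {v}) \<le> D"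
    and "V \<noteq> {}" "D > 0"
    and "finite X" "(card V * (2 * D * (2 * 2 ^ T) ^ D)) ^ t \<le> card X" "t \<le> T"
    and "\<not> embeds V E X R"
  shows "\<exists>S\<subseteq>X. card S = 2 ^ t \<and> indep R S"
  using assms(8-)
proof (induction t arbitrary: X)
  case 0
  then obtain x where "x \<in> X"
    by fastforce
  then show ?case
    by (intro exI[of _ "{x}"]) (simp add: indep_def)
next
  case (Suc t)
  define q :: nat where "q = 2 * 2 ^ T"
  define K where "K = card V * (2 * D * q ^ D)"
  have "K > 0"
    unfolding K_def q_def using V(1) \<open>V \<noteq> {}\<close> \<open>D > 0\<close> by (simp add: card_gt_0_iff)
  \<comment> \<open>Prepares \<open>sparse_pair\<close> with \<open>L = 2 * D * K ^ t\<close>: the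
    \<open>D\<close> cancels against \<open>L \<le> D * card A\<close>, and the 2 pays for
    discarding up to half of \<open>B\<close>.\<close>
  have "K ^ Suc t = card V * (2 * D * K ^ t * q ^ D)"
    by (simp add: K_def)
  moreover have "K ^ Suc t \<le> card X"
    unfolding K_def q_def by (rule Suc.prems(2))
  ultimately have "card V * (2 * D * K ^ t * q ^ D) \<le> card X"
    by (simp only:)
  then obtain A B where AB: "A \<subseteq> X" "B \<subseteq> X" "set_less A B"
      "2 * D * K ^ t \<le> D * card A" "2 * D * K ^ t \<le> card B"
      and sparse: "\<And>a. a \<in> A \<Longrightarrow> q * card (B \<inter> R `` {a}) < card B"
    using sparse_pair[OF V outdeg indeg Suc.prems(1) _ _ _ Suc.prems(4), of "2 * D * K ^ t" q]
      \<open>K > 0\<close> \<open>D > 0\<close> by (auto simp: q_def)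
  have fin: "finite A" "finite B"
    using AB Suc.prems(1) finite_subset by auto
  have "D * (2 * K ^ t) \<le> D * card A"
    using AB(4) by (simp add: ac_simps)
  then have "K ^ t \<le> card A"
    using \<open>D > 0\<close> by simp
  then obtain S where S: "S \<subseteq> A" "card S = 2 ^ t" "indep R S"
    using Suc.IH[of A] fin Suc.prems AB(1) embeds_mono unfolding K_def q_def by (metis Suc_leD)
  have finS: "finite S"
    using S(1) fin finite_subset by auto
  \<comment> \<open>The part of \<open>B\<close> reached from \<open>S\<close>. Each of the
    \<open>2 ^ t\<close> vertices of \<open>S\<close> reaches less than a fraction
    \<open>1 / (2 * 2 ^ T)\<close> of \<open>B\<close>, so \<open>N\<close> is at most half of
    it.\<close>
  define N where "N = (\<Union>a\<in>S. B \<inter> R `` {a})"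
  have "q * card N \<le> q * (\<Sum>a\<in>S. card (B \<inter> R `` {a}))"
    unfolding N_def by (intro mult_le_mono2 card_UN_le finS)
  also have "\<dots> = (\<Sum>a\<in>S. q * card (B \<inter> R `` {a}))"
    by (rule sum_distrib_left)
  also have "\<dots> \<le> (\<Sum>a\<in>S. card B)"
    using sparse S(1) by (intro sum_mono) (auto intro: less_imp_le)
  also have "\<dots> = 2 ^ t * card B"
    using S(2) by simp
  also have "\<dots> \<le> 2 ^ T * card B"
    using Suc.prems(3) by simp
  finally have "2 * card N \<le> card B"
    unfolding q_def by simp
  moreover have "N \<subseteq> B"
    unfolding N_def by auto
  then have "card (B - N) = card B - card N"
    using fin by (meson card_Diff_subset finite_subset)
  moreover have "2 * K ^ t \<le> card B"
    using AB(5) \<open>D > 0\<close> by (simp add: order_trans[rotated])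
  ultimately have "K ^ t \<le> card (B - N)"
    by linarith
  moreover have "\<not> embeds V E (B - N) R"
    using Suc.prems(4) AB(2) embeds_mono[of V E "B - N" R X] by blast
  ultimately obtain S' where S': "S' \<subseteq> B - N" "card S' = 2 ^ t" "indep R S'"
    using Suc.IH[of "B - N"] fin Suc.prems(3) unfolding K_def q_def by auto
  have finS': "finite S'"
    using S'(1) fin finite_subset by blast
  have less: "x < y" if "x \<in> S" "y \<in> S'" for x y
    using AB(3) S(1) S'(1) that unfolding set_less_def by blast
  have "indep R (S \<union> S')"
    unfolding indep_def
  proof (intro ballI impI)
    fix x y assume xy: "x \<in> S \<union> S'" "y \<in> S \<union> S'" "x < y"
    then consider "x \<in> S" "y \<in> S" | "x \<in> S'" "y \<in> S'" | "x \<in> S" "y \<in> S'"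
      using less by (meson UnE less_asym)
    then show "(x, y) \<notin> R"
    proof cases
      case 3
      then show ?thesis
        using S'(1) unfolding N_def by blast
    qed (use S(3) S'(3) xy(3) in \<open>auto simp: indep_def\<close>)
  qed
  moreover have "S \<inter> S' = {}"
    using less by (meson disjoint_iff less_irrefl)
  then have "card (S \<union> S') = 2 ^ Suc t"
    using S S' finS finS' by (simp add: card_Un_disjoint)
  moreover have "S \<union> S' \<subseteq> X"
    using S(1) S'(1) AB by blast
  ultimately show ?case
    by blast
qed

section \<open>Arithmetic of the exponents\<close>

text \<open>Bounds the size demanded by \<open>large_indep\<close> for \<open>T = t\<close> by a
  power of two whose exponent is quadratic in \<open>t\<close>.\<close>

lemma threshold_le:
  assumes "n \<le> 2 ^ a" "(D::nat) > 0"
  shows "(n * (2 * D * (2 * 2 ^ t) ^ D)) ^ t \<le> (2::nat) ^ (t * (a + 2 * D + 1 + D * t))"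
proof -
  have "D \<le> 2 ^ D"
    by (simp add: less_imp_le)
  then have "n * (2 * D * (2 * 2 ^ t) ^ D) \<le> 2 ^ a * (2 * 2 ^ D * (2 * 2 ^ t) ^ D)"
    using assms by (intro mult_le_mono) auto
  also have "\<dots> = 2 ^ (a + (1 + D + (D + t * D)))"
    by (simp add: power_add power_mult power_mult_distrib)
  also have "a + (1 + D + (D + t * D)) = a + 2 * D + 1 + D * t"
    by simp
  finally have "(n * (2 * D * (2 * 2 ^ t) ^ D)) ^ t \<le> (2 ^ (a + 2 * D + 1 + D * t)) ^ t"
    by (intro power_mono) auto
  then show ?thesis
    by (simp only: power_mult[symmetric] mult.commute)
qed

text \<open>Binary logarithm of a vertex count that suffices when \<open>i\<close> relations remain.
  The initial 1 stands for the two final vertices. The first step is only linear in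
  \<open>a\<close>, hence its own clause; afterwards \<open>a\<close> is absorbed by the current
  exponent and every step squares.\<close>

fun size_exponent :: "nat \<Rightarrow> nat \<Rightarrow> nat \<Rightarrow> nat" where
  "size_exponent c a 0 = 1"
| "size_exponent c a (Suc 0) = c * a"
| "size_exponent c a (Suc (Suc i)) = c * (size_exponent c a (Suc i))\<^sup>2"

text \<open>One step takes an exponent \<open>e\<close> of \<open>c\<close> to
  \<open>2 * e + 1\<close> and doubles that of \<open>a\<close>.\<close>

lemma size_exponent_closed: "size_exponent c a (Suc i) = c ^ (2 ^ Suc i - 1) * a ^ 2 ^ i"
proof (induction i)
  case (Suc i)
  have "(1::nat) \<le> 2 ^ Suc i"
    by simp
  then have e: "2 ^ Suc (Suc i) - 1 = Suc ((2 ^ Suc i - 1) * 2 :: nat)"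
    unfolding power_Suc[of 2 "Suc i"] by arith
  have "size_exponent c a (Suc (Suc i)) = c * ((c ^ (2 ^ Suc i - 1))\<^sup>2 * (a ^ 2 ^ i)\<^sup>2)"
    by (simp only: size_exponent.simps Suc.IH power_mult_distrib)
  also have "\<dots> = c ^ Suc ((2 ^ Suc i - 1) * 2) * a ^ (2 ^ i * 2)"
    by (simp only: power_mult[symmetric] power_Suc mult.assoc)
  also have "2 ^ i * 2 = (2 ^ Suc i :: nat)"
    by simp
  finally show ?case
    unfolding e .
qed simp

lemma size_exponent_ge: "a > 0 \<Longrightarrow> c > 0 \<Longrightarrow> a \<le> size_exponent c a (Suc i)"
proof (induction i)
  case (Suc i)
  then have "a \<le> size_exponent c a (Suc i)" "0 < size_exponent c a (Suc i)"
    by auto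
  then have "1 * (a * 1) \<le> c * (size_exponent c a (Suc i) * size_exponent c a (Suc i))"
    using Suc.prems by (intro mult_le_mono) auto
  then show ?case
    by (simp add: power2_eq_square)
qed simp

text \<open>With \<open>t\<close> the current exponent, \<open>t = 1\<close> leaves
  \<open>a + 3 * D + 1\<close>, at most \<open>c * a\<close>. Later \<open>a \<le> t\<close> bounds
  the second factor by \<open>c * t\<close>.\<close>

lemma size_exponent_step:
  assumes "a > 0" "D > 0" "c = 3 * D + 2"
  shows "size_exponent c a i * (a + 2 * D + 1 + D * size_exponent c a i) \<le> size_exponent c a (Suc i)"
proof (cases i)
  case 0
  have "a + (3 * D + 1) * 1 \<le> a + (3 * D + 1) * a"
    using assms by (intro add_left_mono mult_le_mono) auto
  then show ?thesis
    using 0 assms by (simp add: algebra_simps)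
next
  case (Suc j)
  define t where "t = size_exponent c a i"
  have t: "a \<le> t" "1 \<le> t"
    using size_exponent_ge[of a c j] assms Suc by (auto simp: t_def)
  have "a + (2 * D + 1) * 1 + D * t \<le> t + (2 * D + 1) * t + D * t"
    using t by (intro add_mono mult_le_mono) auto
  also have "\<dots> = c * t"
    using assms by (simp add: algebra_simps)
  finally have "t * (a + 2 * D + 1 + D * t) \<le> t * (c * t)"
    by (intro mult_le_mono2) simp
  then show ?thesis
    using Suc by (simp add: t_def power2_eq_square ac_simps)
qed

section \<open>Independence for all relations at once\<close>

text \<open>Separate bounds on in- and out-degrees make the condition invariant under
  reversal.\<close>

definition digraph_of_degree :: "'a set \<Rightarrow> nat \<Rightarrow> 'a rel \<Rightarrow> bool" where
  "digraph_of_degree V D E \<longleftrightarrow> acyclic E \<and> E \<subseteq> V \<times> V \<and>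
     (\<forall>v. card (E `` {v}) \<le> D) \<and> (\<forall>v. card (E\<inverse> `` {v}) \<le> D)"

lemma digraph_of_degree_converse:
  "digraph_of_degree V D E \<Longrightarrow> digraph_of_degree V D (E\<inverse>)"
  unfolding digraph_of_degree_def by (auto simp: acyclic_converse)

text \<open>Each relation may avoid its own digraph \<open>E\<close>, since forward arcs avoid
  \<open>H\<close> and backward arcs its reverse. The set found for the first relation is the ground
  set for the others.\<close>

lemma common_indep:
  fixes X :: "'b::linorder set"
  assumes "finite V" "V \<noteq> {}" "D > 0" "card V \<le> 2 ^ a" "a > 0" "c = 3 * D + 2"
    and "finite X" "2 ^ size_exponent c a (length Rs) \<le> card X"
    and "\<And>R. R \<in> set Rs \<Longrightarrow> \<exists>E. digraph_of_degree V D E \<and> \<not> embeds V E X R"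
  shows "\<exists>S\<subseteq>X. card S \<ge> 2 \<and> (\<forall>R\<in>set Rs. indep R S)"
  using assms(7-)
proof (induction Rs arbitrary: X)
  case Nil
  then show ?case by auto
next
  case (Cons R Rs)
  define t where "t = size_exponent c a (length Rs)"
  obtain E where E: "acyclic E" "E \<subseteq> V \<times> V" "\<And>v. card (E `` {v}) \<le> D"
      "\<And>v. card (E\<inverse> `` {v}) \<le> D" "\<not> embeds V E X R"
    using Cons.prems(3)[of R] unfolding digraph_of_degree_def by auto
  have "(card V * (2 * D * (2 * 2 ^ t) ^ D)) ^ t \<le> 2 ^ (t * (a + 2 * D + 1 + D * t))"
    using threshold_le assms by blast
  also have "\<dots> \<le> 2 ^ size_exponent c a (length (R # Rs))"
    using size_exponent_step[of a D c "length Rs"] assms unfolding t_def by (intro power_increasing) auto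
  also have "\<dots> \<le> card X"
    by (rule Cons.prems)
  finally obtain Y where Y: "Y \<subseteq> X" "card Y = 2 ^ t" "indep R Y"
    using large_indep[OF assms(1) E(1-4) assms(2,3) Cons.prems(1) _ _ E(5), of t t] by auto
  have "finite Y"
    using Y Cons.prems(1) finite_subset by blast
  moreover have "\<exists>E. digraph_of_degree V D E \<and> \<not> embeds V E Y R'" if "R' \<in> set Rs" for R'
    using Cons.prems(3)[of R'] that Y(1) embeds_mono by (metis list.set_intros(2))
  ultimately obtain S where "S \<subseteq> Y" "card S \<ge> 2" "\<forall>R\<in>set Rs. indep R S"
    using Cons.IH[of Y] Y(2) unfolding t_def by auto
  moreover have "indep R S"
    using Y(3) \<open>S \<subseteq> Y\<close> unfolding indep_def by blast
  ultimately show ?case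
    using Y(1) by (intro exI[of _ S]) auto
qed

lemma tournament_has_mono_copy:
  fixes H :: "'a pair_pre_digraph" and T :: "'b::linorder pair_pre_digraph"
  assumes "oriented_digraph H" "acyclic (parcs H)" "pverts H \<noteq> {}" "max_degree H \<le> D" "D > 0"
    and "card (pverts H) \<le> 2 ^ a" "a > 0"
    and "tournament T" "edge_coloring k T col" "2 ^ size_exponent (3 * D + 2) a (2 * k) \<le> card (pverts T)"
  shows "has_mono_copy k H T col"
proof (rule ccontr)
  assume contra: "\<not> has_mono_copy k H T col"
  interpret H: oriented_digraph H by fact
  interpret T: tournament T by fact
  define R where "R i = {e \<in> parcs T. col e = i}" for i
  have no: "\<not> embeds (pverts H) (parcs H) (pverts T) (R i)" if "i < k" for i
  proof
    assume "embeds (pverts H) (parcs H) (pverts T) (R i)"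
    then obtain f where f: "inj_on f (pverts H)" "f ` pverts H \<subseteq> pverts T"
      "\<And>u v. (u, v) \<in> parcs H \<Longrightarrow> (f u, f v) \<in> R i"
      unfolding embeds_def by blast
    have "is_copy H T f" "\<forall>u v. (u, v) \<in> parcs H \<longrightarrow> col (f u, f v) = i"
      using f unfolding is_copy_def R_def by auto
    then show False
      using contra that unfolding has_mono_copy_def by blast
  qed
  have sub: "parcs H \<subseteq> pverts H \<times> pverts H"
    using H.in_arcsD1 H.in_arcsD2 by auto
  have deg: "card (out_nbrs H v) + card (in_nbrs H v) \<le> D" for v
  proof (cases "v \<in> pverts H")
    case True
    then have "card (out_nbrs H v) + card (in_nbrs H v) \<le> max_degree H"
      unfolding max_degree_def by (intro Max_ge) auto
    then show ?thesis
      using assms(4) by linarith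
  next
    case False
    then have "out_nbrs H v = {}" "in_nbrs H v = {}"
      using sub unfolding out_nbrs_def in_nbrs_def by auto
    then show ?thesis by simp
  qed
  have "parcs H `` {v} = out_nbrs H v" "(parcs H)\<inverse> `` {v} = in_nbrs H v" for v
    unfolding out_nbrs_def in_nbrs_def by auto
  then have H: "digraph_of_degree (pverts H) D (parcs H)"
    using assms(2) sub deg unfolding digraph_of_degree_def by (metis add_leD1 add_leD2)
  \<comment> \<open>Both orientations of every colour, so that any arc inside a common independent
    set is excluded.\<close>
  define Rs where "Rs = map R [0..<k] @ map (\<lambda>i. (R i)\<inverse>) [0..<k]"
  have len: "length Rs = 2 * k"
    unfolding Rs_def by simp
  have "\<exists>E. digraph_of_degree (pverts H) D E \<and> \<not> embeds (pverts H) E (pverts T) Q"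
    if "Q \<in> set Rs" for Q
  proof -
    from that obtain i where "i < k" "Q = R i \<or> Q = (R i)\<inverse>"
      unfolding Rs_def by auto
    then show ?thesis
      using no[of i] H digraph_of_degree_converse[OF H] embeds_converse by metis
  qed
  then obtain S where S: "S \<subseteq> pverts T" "card S \<ge> 2" "\<And>Q. Q \<in> set Rs \<Longrightarrow> indep Q S"
    using common_indep[of "pverts H" D a "3 * D + 2" "pverts T" Rs] assms len by auto
  then obtain x y where xy: "x \<in> S" "y \<in> S" "x < y"
    by (metis (full_types) card_le_Suc0_iff_eq linorder_neqE not_less_eq_eq numeral_2_eq_2
      T.finite_verts finite_subset)
  then have "(x, y) \<in> parcs T \<or> (y, x) \<in> parcs T"
    using S(1) T.semicomplete by (metis less_irrefl subsetD)
  then obtain i where "i < k" "(x, y) \<in> R i \<or> (x, y) \<in> (R i)\<inverse>"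
    using assms(9) unfolding edge_coloring_def R_def by auto
  moreover have "indep (R i) S" "indep ((R i)\<inverse>) S"
    using S(3) \<open>i < k\<close> unfolding Rs_def by auto
  ultimately show False
    using xy unfolding indep_def by blast
qed

section \<open>Bounding the Ramsey number\<close>

lemma oriented_ramsey_le:
  assumes "\<And>(T :: nat pair_pre_digraph) c.
    \<lbrakk>tournament T; card (pverts T) = N; edge_coloring k T c\<rbrakk> \<Longrightarrow> has_mono_copy k H T c"
  shows "oriented_ramsey k H \<le> N"
  unfolding oriented_ramsey_def using assms by (intro Least_le) blast

text \<open>Covers the digraphs for which the logarithm vanishes and the claimed bound is 1. They
  have no edges, so any colour serves.\<close>

lemma oriented_ramsey_le_1:
  assumes "oriented_digraph H" "card (pverts H) \<le> 1" "k \<ge> 1"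
  shows "oriented_ramsey k H \<le> 1"
proof (rule oriented_ramsey_le)
  fix T :: "nat pair_pre_digraph" and c
  assume "card (pverts T) = 1"
  then obtain t where t: "pverts T = {t}"
    by (meson card_1_singletonE)
  interpret H: oriented_digraph H by fact
  have single: "u = v" if "u \<in> pverts H" "v \<in> pverts H" for u v
    using that assms(2) H.finite_verts by (metis One_nat_def card_le_Suc0_iff_eq)
  then have "(u, v) \<notin> parcs H" for u v
    using H.arc_fst_in_verts H.arc_snd_in_verts H.no_loops by fastforce
  then show "has_mono_copy k H T c"
    using single t assms(3) unfolding has_mono_copy_def is_copy_def inj_on_def
    by (intro exI[of _ "\<lambda>_. t"]) (auto intro: exI[of _ 0])
qed

theorem theorem1p7:
  fixes k \<Delta> :: nat
  assumes "k \<ge> 1"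
  shows "\<exists>C::real. \<forall>(H :: 'a pair_pre_digraph) (n::nat).
           oriented_digraph H \<and> acyclic (parcs H) \<and> card (pverts H) = n \<and> max_degree H = \<Delta> \<longrightarrow>
           real (oriented_ramsey k H) \<le> 2 powr (C * (log 2 (real n)) ^ (2 ^ (2 * k - 1)))"
proof -
  \<comment> \<open>The successor keeps \<open>D\<close> positive when
    \<open>\<Delta> = 0\<close>.\<close>
  define D where "D = Suc \<Delta>"
  define c where "c = 3 * D + 2"
  define p :: nat where "p = 2 ^ (2 * k - 1)"
  \<comment> \<open>The power of \<open>c\<close> comes from \<open>size_exponent_closed\<close> at
    index \<open>2 * k - 1\<close>, and \<open>2 ^ p\<close> from rounding the logarithm up.\<close>
  define C :: real where "C = real c ^ (2 ^ (2 * k) - 1) * 2 ^ p"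
  have "real (oriented_ramsey k H) \<le> 2 powr (C * log 2 (real n) ^ p)"
    if H: "oriented_digraph H" "acyclic (parcs H)" "card (pverts H) = n" "max_degree H = \<Delta>"
    for H :: "'a pair_pre_digraph" and n
  proof (cases "n \<le> 1")
    case True
    \<comment> \<open>For \<open>n = 0\<close> this is the default value of
      \<open>log\<close>.\<close>
    then have "log 2 (real n) = 0"
      by (auto simp: le_Suc_eq log_def)
    moreover have "p > 0"
      unfolding p_def by simp
    ultimately have exponent: "C * log 2 (real n) ^ p = 0"
      by (simp add: zero_power)
    show ?thesis
      unfolding exponent using oriented_ramsey_le_1[of H k] H True assms by simp
  next
    case False
    define l where "l = log 2 (real n)"
    define a where "a = nat \<lceil>l\<rceil>"
    have "l \<ge> 1"
      unfolding l_def using False by simp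
    \<comment> \<open>Since \<open>l \<ge> 1\<close>, rounding up at most doubles it.\<close>
    then have "a > 0" "l \<le> real a" "real a \<le> 2 * l"
      unfolding a_def by linarith+
    have "real n \<le> 2 powr real a"
      using \<open>l \<le> real a\<close> False unfolding l_def by (simp add: log_le_iff)
    then have "n \<le> 2 ^ a"
      by (simp add: powr_realpow)
    have "pverts H \<noteq> {}"
      using H(3) False by auto
    have "oriented_ramsey k H \<le> 2 ^ size_exponent c a (2 * k)"
    proof (rule oriented_ramsey_le)
      fix T :: "nat pair_pre_digraph" and col
      assume "tournament T" "card (pverts T) = 2 ^ size_exponent c a (2 * k)" "edge_coloring k T col"
      then show "has_mono_copy k H T col"
        using tournament_has_mono_copy[of H D a T k col] H \<open>pverts H \<noteq> {}\<close> \<open>n \<le> 2 ^ a\<close> \<open>a > 0\<close>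
        unfolding c_def D_def by auto
    qed
    then have "real (oriented_ramsey k H) \<le> real (2 ^ size_exponent c a (2 * k))"
      by (simp only: of_nat_le_iff)
    also have "\<dots> = 2 powr real (size_exponent c a (2 * k))"
      by (simp add: powr_realpow)
    also have "real (size_exponent c a (2 * k)) \<le> C * l ^ p"
    proof -
      have "2 * k = Suc (2 * k - 1)"
        using assms by simp
      then have "size_exponent c a (2 * k) = c ^ (2 ^ (2 * k) - 1) * a ^ p"
        using size_exponent_closed[of c a "2 * k - 1"] unfolding p_def by simp
      then have "real (size_exponent c a (2 * k)) = real c ^ (2 ^ (2 * k) - 1) * real a ^ p"
        by simp
      also have "\<dots> \<le> real c ^ (2 ^ (2 * k) - 1) * (2 * l) ^ p"
        using \<open>real a \<le> 2 * l\<close> by (intro mult_left_mono power_mono) auto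
      finally show ?thesis
        unfolding C_def by (simp add: power_mult_distrib)
    qed
    finally show ?thesis
      unfolding l_def by simp
  qed
  then show ?thesis
    unfolding p_def by blast
qed

end
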